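(* Let $k,L\to\infty$ while $\rho_l<\log L/\log k<\rho_u$ for some constants $0<\rho_l<\rho_u<\infty$, and fix $\gamma>4$. Consider the random graph model $B(L,k)$ with arc sizes $L_1,\dots,L_k$, and let $$q(z)=\sum_{i=1}^k z^{-L_i},\qquad R_\gamma=\left\{z\in\mathbb{C}: 1-\frac{1}{L\log^\gamma k}\le |z|\le 1,\ z\ne 1\right\}.$$ Then for any $c,d>0$, $$P\left(\exists z\in R_\gamma:\ q(z)=k\right)=O(k^{-c}L^{-d}).$$ Consequently, the mixing rate $\lambda$ of the pure drift Markov chain on a random graph from $B(L,k)$ satisfies $\lambda>1/(L\log^\gamma k)$ asymptotically almost surely.
   Context: Random graph $B(L,k)$ ($L\in(1,\infty)$, $k\in\mathbb{Z}^+$): let $L_1,\dots,L_k$ be independent geometric random variables with parameter $1/L$ and smallest possible value $1$, i.e. $P(L_i=l)=(1-1/L)^{l-1}/L$ for $l\ge 1$. Take the disjoint union of $k$ arcs, the $i$th being a path with $L_i$ nodes, with a start point $a_i$ and an end point $b_i$ ($a_i=b_i$ if $L_i=1$). Then add all edges $(b_i,a_j)$, $1\le i,j\le k$ (including $i=j$). Pure drift Markov chain: within each arc, from every node other than $b_i$ the chain moves with probability $1$ to the next node of the arc in the direction from $a_i$ to $b_i$; from $b_i$ it moves to each $a_j$, $1\le j\le k$, with probability $1/k$. Mixing rate: for a Markov chain with transition matrix $P$, $\lambda=\min\{1-|\mu| : \mu\ne 1 \text{ is an eigenvalue of } P\}$ (complex eigenvalues). Notation: $\log$ is the natural logarithm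 and $\log^\gamma k=(\log k)^\gamma$. "Asymptotically almost surely" means with probability tending to $1$ in the stated limit. *)

theory Defs
  imports
    "HOL-Probability.Probability"
    "HOL-Library.Landau_Symbols"
    "Jordan_Normal_Form.Char_Poly"
begin

(* The model B(L,k), represented by its arc sizes: arc i (for i < k) is the path on the
   nodes (i,0), ..., (i, len i - 1), so that a_i = (i,0) and b_i = (i, len i - 1). *)

type_synonym node = "nat \<times> nat"

(* The library's geometric distribution lives on {0,1,...}, hence the shift by Suc.
   The value 0 is the dummy value of the sampled function at indices i >= k. *)
definition B_graph :: "real \<Rightarrow> nat \<Rightarrow> (nat \<Rightarrow> nat) pmf" where
  "B_graph L k = Pi_pmf {..<k} 0 (\<lambda>_. map_pmf Suc (geometric_pmf (1 / L)))"

lemma B_graph_arc_size_pos: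
  assumes "len \<in> set_pmf (B_graph L k)" and "i < k"
  shows "1 \<le> len i"
  using assms by (auto simp: B_graph_def set_Pi_pmf PiE_dflt_def)

definition arc_start :: "nat \<Rightarrow> node" where
  "arc_start i = (i, 0)"

definition arc_end :: "(nat \<Rightarrow> nat) \<Rightarrow> nat \<Rightarrow> node" where
  "arc_end len i = (i, len i - 1)"

definition nodes :: "nat \<Rightarrow> (nat \<Rightarrow> nat) \<Rightarrow> node set" where
  "nodes k len = (SIGMA i:{..<k}. {..<len i})"

(* Undirected edges as sets of end points; a loop is a singleton. *)
definition edges :: "nat \<Rightarrow> (nat \<Rightarrow> nat) \<Rightarrow> node set set" where
  "edges k len =
     {{(i, t), (i, Suc t)} | i t. i < k \<and> Suc t < len i} \<union>
     {{arc_end len i, arc_start j} | i j. i < k \<and> j < k}"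

definition pure_drift_step :: "nat \<Rightarrow> (nat \<Rightarrow> nat) \<Rightarrow> node \<Rightarrow> node pmf" where
  "pure_drift_step k len x =
     (if x = arc_end len (fst x) then map_pmf arc_start (pmf_of_set {..<k})
      else return_pmf (fst x, Suc (snd x)))"

lemma pure_drift_step_along_edges:
  assumes len: "\<And>i. i < k \<Longrightarrow> 1 \<le> len i"
    and x: "x \<in> nodes k len" and y: "y \<in> set_pmf (pure_drift_step k len x)"
  shows "y \<in> nodes k len \<and> {x, y} \<in> edges k len"
proof -
  obtain i t where it: "x = (i, t)" "i < k" "t < len i"
    using x by (auto simp: nodes_def)
  show ?thesis
  proof (cases "x = arc_end len i")
    case True
    have "set_pmf (pmf_of_set {..<k}) = {..<k}"
      using it by (intro set_pmf_of_set) auto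
    then obtain j where j: "j < k" "y = arc_start j"
      using y True it by (auto simp: pure_drift_step_def arc_end_def)
    moreover have "arc_start j \<in> nodes k len"
      using len[of j] j by (auto simp: nodes_def arc_start_def)
    moreover have "{x, y} \<in> edges k len"
      using True it j unfolding edges_def by blast
    ultimately show ?thesis by simp
  next
    case False
    then have y: "y = (i, Suc t)" and "t \<noteq> len i - 1"
      using y it by (auto simp: pure_drift_step_def arc_end_def)
    then have "Suc t < len i" using it by linarith
    then show ?thesis
      using it y unfolding edges_def nodes_def by auto
  qed
qed

(* An enumeration of the nodes, used to index the rows and columns of the transition matrix. *)
definition node_list :: "nat \<Rightarrow> (nat \<Rightarrow> nat) \<Rightarrow> node list" where
  "node_list k len = [(i, t). i \<leftarrow> [0..<k], t \<leftarrow> [0..<len i]]"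

lemma set_node_list: "set (node_list k len) = nodes k len"
  by (auto simp: node_list_def nodes_def)

lemma distinct_node_list: "distinct (node_list k len)"
  unfolding node_list_def
  by (induction k) (auto simp: distinct_map inj_on_def)

definition transition_matrix :: "'a list \<Rightarrow> ('a \<Rightarrow> 'a pmf) \<Rightarrow> real mat" where
  "transition_matrix xs K =
     mat (length xs) (length xs) (\<lambda>(r, s). pmf (K (xs ! r)) (xs ! s))"

definition pure_drift_matrix :: "nat \<Rightarrow> (nat \<Rightarrow> nat) \<Rightarrow> real mat" where
  "pure_drift_matrix k len = transition_matrix (node_list k len) (pure_drift_step k len)"

definition mixing_rate :: "real mat \<Rightarrow> real" where
  "mixing_rate P =
     Min {1 - cmod \<mu> | \<mu>. eigenvalue (map_mat complex_of_real P) \<mu> \<and> \<mu> \<noteq> 1}"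

definition q_fun :: "nat \<Rightarrow> (nat \<Rightarrow> nat) \<Rightarrow> complex \<Rightarrow> complex" where
  "q_fun k len z = (\<Sum>i<k. z powi (- int (len i)))"

definition R_region :: "real \<Rightarrow> nat \<Rightarrow> real \<Rightarrow> complex set" where
  "R_region \<gamma> k L = {z. 1 - 1 / (L * ln (real k) powr \<gamma>) \<le> cmod z \<and> cmod z \<le> 1 \<and> z \<noteq> 1}"

(* The limit k, L \<rightarrow> \<infinity> (jointly, in any manner) subject to the constraint on ln L / ln k. *)
definition regime :: "real \<Rightarrow> real \<Rightarrow> (nat \<times> real) filter" where
  "regime \<rho>l \<rho>u =
     inf (at_top \<times>\<^sub>F at_top)
         (principal {(k, L). \<rho>l < ln L / ln (real k) \<and> ln L / ln (real k) < \<rho>u})"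

end

theory Submission
  imports Defs "HOL-Real_Asymp.Real_Asymp"
begin

text \<open>
  Write \<open>z = r e\<^sup>i\<^sup>\<theta>\<close> with \<open>1 - x \<le> r \<le> 1\<close>, where \<open>x = 1 / (L (ln k)\<^sup>\<gamma>)\<close>, and suppose
  that all arcs have at most \<open>M = A L ln k\<close> nodes. Then the moduli of
  the terms of \<open>q(z)\<close> all lie in \<open>[1, 1 + 2 M x]\<close>, and
  \<open>2 M x = 2 A (ln k)\<^bsup>1 - \<gamma>\<^esup>\<close> is tiny. The equation \<open>q(z) = k\<close> says that these
  terms have real parts summing to \<open>k\<close> and imaginary parts summing to \<open>0\<close>.

  The imaginary parts exclude small angles: if \<open>0 < \<bar>\<theta>\<bar> M < \<pi>\<close>, they all have the same strict
  sign, and if \<open>\<theta> = 0\<close> the real parts force \<open>z = 1\<close>. The real parts force the angles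
  \<open>\<theta> L\<^sub>i\<close> to be close to multiples of \<open>2 \<pi>\<close>, in the sense that the deficit
  \<open>\<Sum>\<^sub>i (1 - cos (\<theta> L\<^sub>i))\<close> is at most \<open>2 M x k\<close> (\<open>q_fun_root_near_unit_circle\<close>). But once
  \<open>\<bar>\<theta>\<bar>\<close> is at least of order \<open>1 / M\<close>, the mean of \<open>1 - cos (\<theta> L\<^sub>i)\<close> is of order at least
  \<open>(ln k)\<^bsup>-2\<^esup>\<close> (\<open>expectation_one_minus_cos_geometric_ge\<close>), which dominates
  \<open>2 M x\<close>. A Chernoff bound for independent bounded variables (\<open>prob_Pi_pmf_sum_le\<close>) therefore
  makes a small deficit at one given angle exponentially unlikely in \<open>k / (ln k)\<^sup>2\<close>. The deficit
  changes slowly with \<open>\<theta>\<close>, so a grid of \<open>O(L (ln k)\<^sup>\<gamma>)\<close> angles suffices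
  (\<open>cos_deficit_round_to_grid\<close>); as \<open>L\<close> is at most a power of \<open>k\<close>, a union bound over the grid
  still gives less than any power of \<open>k\<close>. An arc longer than \<open>M\<close> occurs with probability at
  most \<open>e k\<^bsup>1 - A\<^esup>\<close>, and \<open>A\<close> is chosen according to the exponents \<open>c\<close> and
  \<open>d\<close>.

  For the mixing rate, an eigenvector of the transition matrix for an eigenvalue \<open>\<mu> \<noteq> 0\<close> is
  geometric along every arc, and the equation at the arc ends becomes \<open>q(\<mu>) = k\<close>
  (\<open>eigenvalue_imp_q_fun_eq\<close>). So an eigenvalue \<open>\<mu> \<noteq> 1\<close> too close to the unit circle is a root
  of the kind excluded above.
\<close>

section \<open>Geometric random variables\<close>

lemma expectation_geometric_pmf_eqI:
  fixes f :: "nat \<Rightarrow> real"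
  assumes p: "0 < p" "p \<le> 1"
    and f: "\<And>n. 0 \<le> f n"
    and s: "(\<lambda>n. (1 - p) ^ n * p * f n) sums a"
  shows "measure_pmf.expectation (geometric_pmf p) f = a"
proof -
  have "measure_pmf.expectation (geometric_pmf p) f
      = (\<integral>n. pmf (geometric_pmf p) n * f n \<partial>count_space UNIV)"
    unfolding measure_pmf_eq_density by (subst integral_density) auto
  also have "\<dots> = (\<Sum>n. (1 - p) ^ n * p * f n)"
    using s p f
    by (subst integral_count_space_nat)
       (auto simp: integrable_count_space_nat_iff sums_iff abs_mult)
  finally show ?thesis
    using s by (simp add: sums_iff)
qed

text \<open>
  The characteristic function of the geometric distribution on the positive integers is the geometric
  series \<open>p w / (1 - (1 - p) w)\<close> with \<open>w = e\<^sup>i\<^sup>\<theta>\<close>; this is the real part of one minus it.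
\<close>

lemma expectation_one_minus_cos_geometric:
  fixes p \<theta> :: real
  assumes p: "0 < p" "p \<le> 1"
  shows "measure_pmf.expectation (geometric_pmf p) (\<lambda>n. 1 - cos (\<theta> * real (Suc n)))
       = (2 - p) * (1 - cos \<theta>) / (p\<^sup>2 + 2 * (1 - p) * (1 - cos \<theta>))"
proof (rule expectation_geometric_pmf_eqI[OF p])
  define w where "w = cis \<theta>"
  have n1: "norm (of_real (1 - p) * w) < 1"
    using p by (simp add: w_def norm_mult del: of_real_diff)
  have "(\<lambda>n. of_real p * w * (of_real (1 - p) * w) ^ n) sums
          (of_real p * w * (1 / (1 - of_real (1 - p) * w)))"
    by (intro sums_mult geometric_sums n1)
  then have "(\<lambda>n. Re (of_real p * w * (of_real (1 - p) * w) ^ n)) sums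
          Re (of_real p * w * (1 / (1 - of_real (1 - p) * w)))"
    by (rule sums_Re)
  also have "(\<lambda>n. Re (of_real p * w * (of_real (1 - p) * w) ^ n))
      = (\<lambda>n. (1 - p) ^ n * p * cos (\<theta> * real (Suc n)))"
  proof
    fix n
    have "of_real p * w * (of_real (1 - p) * w) ^ n = of_real ((1 - p) ^ n * p) * w ^ Suc n"
      by (simp add: power_mult_distrib)
    also have "w ^ Suc n = cis (real (Suc n) * \<theta>)"
      unfolding w_def by (rule Complex.DeMoivre)
    finally show "Re (of_real p * w * (of_real (1 - p) * w) ^ n)
        = (1 - p) ^ n * p * cos (\<theta> * real (Suc n))"
      by (simp add: mult.commute del: of_real_diff of_real_mult of_real_power)
  qed
  finally have "(\<lambda>n. (1 - p) ^ n * p - (1 - p) ^ n * p * cos (\<theta> * real (Suc n))) sums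
      (1 - Re (of_real p * w * (1 / (1 - of_real (1 - p) * w))))"
    using geometric_sums[of "1 - p"] p sums_mult2[of "\<lambda>n. (1 - p) ^ n" "1 / p" p]
    by (intro sums_diff) auto
  \<comment> \<open>rationalise the denominator, using \<open>sin\<^sup>2 + cos\<^sup>2 = 1\<close>\<close>
  also have "1 - Re (of_real p * w * (1 / (1 - of_real (1 - p) * w)))
     = (2 - p) * (1 - cos \<theta>) / (p\<^sup>2 + 2 * (1 - p) * (1 - cos \<theta>))"
  proof -
    have sq: "(sin \<theta>)\<^sup>2 = 1 - (cos \<theta>)\<^sup>2"
      by (simp add: sin_squared_eq)
    have dn: "(1 - (1 - p) * cos \<theta>)\<^sup>2 + ((1 - p) * sin \<theta>)\<^sup>2 = p\<^sup>2 + 2 * (1 - p) * (1 - cos \<theta>)"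
      by (simp add: power_mult_distrib sq) (simp add: power2_eq_square algebra_simps)
    have pos: "p\<^sup>2 + 2 * (1 - p) * (1 - cos \<theta>) > 0"
      using p by (intro add_pos_nonneg) auto
    have "Re (of_real p * w * (1 / (1 - of_real (1 - p) * w)))
       = (p * cos \<theta> * (1 - (1 - p) * cos \<theta>) - p * (1 - p) * (sin \<theta>)\<^sup>2)
         / ((1 - (1 - p) * cos \<theta>)\<^sup>2 + ((1 - p) * sin \<theta>)\<^sup>2)"
      by (simp add: w_def Re_divide power2_eq_square del: of_real_diff)
    also note dn
    finally have "Re (of_real p * w * (1 / (1 - of_real (1 - p) * w)))
       = (p * cos \<theta> * (1 - (1 - p) * cos \<theta>) - p * (1 - p) * (sin \<theta>)\<^sup>2)
         / (p\<^sup>2 + 2 * (1 - p) * (1 - cos \<theta>))" .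
    then show ?thesis
      using pos by (simp add: sq field_simps) (simp add: power2_eq_square algebra_simps)
  qed
  finally show "(\<lambda>n. (1 - p) ^ n * p * (1 - cos (\<theta> * real (Suc n)))) sums \<dots>"
    by (simp add: algebra_simps)
qed auto

text \<open>
  The event is treated as the expectation of its indicator: the tail series is geometric, and the
  first \<open>n\<close> terms vanish.
\<close>

lemma prob_geometric_ge:
  assumes "0 < p" "p \<le> 1"
  shows "measure_pmf.prob (geometric_pmf p) {n..} = (1 - p) ^ n"
proof -
  have "(\<lambda>j. p * (1 - p) ^ n * (1 - p) ^ j) sums (p * (1 - p) ^ n * (1 / (1 - (1 - p))))"
    by (intro sums_mult geometric_sums) (use assms in auto)
  then have "(\<lambda>j. (1 - p) ^ (j + n) * p * indicator {n..} (j + n)) sums (1 - p) ^ n"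
    using assms by (simp add: power_add mult_ac)
  then have "(\<lambda>j. (1 - p) ^ j * p * indicator {n..} j) sums
      ((1 - p) ^ n + (\<Sum>i<n. (1 - p) ^ i * p * indicator {n..} i))"
    by (subst (asm) sums_iff_shift) simp
  then have "measure_pmf.expectation (geometric_pmf p) (indicator {n..})
      = (1 - p) ^ n + (\<Sum>i<n. (1 - p) ^ i * p * indicator {n..} i)"
    by (intro expectation_geometric_pmf_eqI assms) auto
  then show ?thesis by simp
qed

section \<open>A lower-tail bound for sums of independent bounded variables\<close>

text \<open>
  The exponential Markov inequality with parameter \<open>-1\<close>. The factor \<open>1 / 3\<close> comes from
  \<open>exp (- y) \<le> 1 / (1 + y) \<le> 1 - y / 3\<close>, valid for \<open>0 \<le> y \<le> 2\<close>. Because the bound is linear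
  in the mean, it remains strong when the mean itself tends to \<open>0\<close>, where a bound in terms of the
  squared deviation loses a factor of the mean.
\<close>

lemma prob_Pi_pmf_sum_le:
  fixes f :: "'b \<Rightarrow> real"
  assumes fin: "finite A"
    and f: "\<And>x. 0 \<le> f x" "\<And>x. f x \<le> 2"
  shows "measure_pmf.prob (Pi_pmf A dflt (\<lambda>_. P)) {g. (\<Sum>i\<in>A. f (g i)) \<le> a}
           \<le> exp (a - real (card A) * measure_pmf.expectation P f / 3)"
proof -
  let ?M = "Pi_pmf A dflt (\<lambda>_. P)"
  define m where "m = measure_pmf.expectation P f"
  have intf: "integrable P f"
    by (rule measure_pmf.integrable_const_bound[where B = 2]) (use f in auto)
  have inte: "integrable P (\<lambda>x. exp (- f x))"
    by (rule measure_pmf.integrable_const_bound[where B = 1]) (use f in auto)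
  have lin: "exp (- f x) \<le> 1 - f x / 3" for x
  proof -
    have "exp (- f x) = 1 / exp (f x)" by (simp add: exp_minus field_simps)
    also have "\<dots> \<le> 1 / (1 + f x)"
      using f(1)[of x] by (intro divide_left_mono exp_ge_add_one_self) (auto intro!: mult_pos_pos add_pos_nonneg)
    also have "\<dots> \<le> 1 - f x / 3"
    proof -
      have "0 \<le> f x * (2 - f x)" using f by simp
      then have "1 \<le> (1 - f x / 3) * (1 + f x)" by (simp add: algebra_simps)
      then show ?thesis using f(1)[of x] by (simp add: divide_le_eq)
    qed
    finally show ?thesis .
  qed
  have "measure_pmf.expectation P (\<lambda>x. exp (- f x)) \<le> measure_pmf.expectation P (\<lambda>x. 1 - f x / 3)"
    by (intro integral_mono inte lin) (use intf in auto)
  also have "\<dots> = 1 - m / 3"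
    using intf by (simp add: m_def)
  also have "\<dots> \<le> exp (- m / 3)"
    using exp_ge_add_one_self[of "- m / 3"] by simp
  finally have one: "measure_pmf.expectation P (\<lambda>x. exp (- f x)) \<le> exp (- m / 3)" .
  have "measure_pmf.prob ?M {g. (\<Sum>i\<in>A. f (g i)) \<le> a}
      = measure_pmf.prob ?M {g \<in> space ?M. (\<Prod>i\<in>A. exp (- f (g i))) \<ge> exp (- a)}"
    using fin by (simp add: exp_sum[symmetric] sum_negf)
  also have "\<dots> \<le> measure_pmf.expectation ?M (\<lambda>g. \<Prod>i\<in>A. exp (- f (g i))) / exp (- a)"
  proof (rule integral_Markov_inequality_measure[where A = "{}"])
    show "integrable (measure_pmf ?M) (\<lambda>g. \<Prod>i\<in>A. exp (- f (g i)))"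
      by (rule measure_pmf.integrable_const_bound[where B = 1])
         (use f in \<open>auto simp: abs_prod intro!: prod_le_1\<close>)
  qed (auto intro!: prod_nonneg)
  also have "measure_pmf.expectation ?M (\<lambda>g. \<Prod>i\<in>A. exp (- f (g i)))
      = (\<Prod>i\<in>A. measure_pmf.expectation P (\<lambda>x. exp (- f x)))"
    using fin inte by (intro expectation_prod_Pi_pmf) auto
  also have "(\<Prod>i\<in>A. measure_pmf.expectation P (\<lambda>x. exp (- f x))) / exp (- a)
      \<le> exp (- m / 3) ^ card A / exp (- a)"
    using one by (auto intro!: divide_right_mono power_mono integral_nonneg_AE)
  also have "\<dots> = exp (a - real (card A) * m / 3)"
    by (simp add: exp_of_nat_mult[symmetric] exp_diff[symmetric] exp_minus[symmetric] field_simps exp_diff exp_minus)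
  finally show ?thesis by (simp add: m_def)
qed

section \<open>Roots of \<open>q(z) = k\<close> near the unit circle\<close>

text \<open>
  Bernoulli's inequality gives \<open>r ^ n \<ge> 1 - n x\<close>, and \<open>1 / (1 - y) \<le> 1 + 2 y\<close> for
  \<open>0 \<le> y \<le> 1 / 2\<close>.
\<close>

lemma inverse_power_le_of_near_1:
  fixes r x :: real
  assumes x: "0 \<le> x" "1 - x \<le> r" and n: "2 * (real n * x) \<le> 1"
  shows "1 / r ^ n \<le> 1 + 2 * (real n * x)"
proof (cases "n = 0")
  case False
  define y where "y = real n * x"
  have y: "0 \<le> y" "2 * y \<le> 1" using x n by (auto simp: y_def)
  have "x \<le> real n * x" using False x(1) by (simp add: mult_le_cancel_right1)
  then have x1: "x \<le> 1 / 2" using n by linarith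
  have "1 - y \<le> (1 - x) ^ n"
    using Bernoulli_inequality[of "- x" n] x1 by (simp add: y_def)
  also have "\<dots> \<le> r ^ n" using x x1 by (intro power_mono) auto
  finally have le: "1 - y \<le> r ^ n" .
  have "1 / r ^ n \<le> 1 / (1 - y)"
    using le y by (intro divide_left_mono) (auto intro!: mult_pos_pos)
  also have "\<dots> \<le> 1 + 2 * y"
  proof -
    have "0 \<le> y * (1 - 2 * y)" using y by simp
    then have "1 \<le> (1 + 2 * y) * (1 - y)" by (simp add: algebra_simps)
    then show ?thesis using y by (simp add: divide_le_eq)
  qed
  finally show ?thesis by (simp add: y_def)
qed auto

lemma q_fun_polar:
  "q_fun k len (rcis r \<theta>)
     = of_real (\<Sum>i<k. cos (\<theta> * real (len i)) / r ^ len i)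
       - \<i> * of_real (\<Sum>i<k. sin (\<theta> * real (len i)) / r ^ len i)"
proof -
  have "rcis r \<theta> powi (- int n)
      = of_real (cos (\<theta> * real n) / r ^ n) - \<i> * of_real (sin (\<theta> * real n) / r ^ n)" for n
    by (simp add: power_int_minus DeMoivre2 rcis_inverse)
       (simp add: complex_eq_iff mult.commute inverse_eq_divide)
  then show ?thesis
    by (simp add: q_fun_def sum_subtractf sum_distrib_left)
qed

text \<open>
  The angle is \<open>\<theta> = \<bar>Arg z\<bar>\<close>; only \<open>\<bar>Arg z\<bar>\<close> matters because \<open>cos\<close> is even and the
  imaginary parts just change sign. The real part of \<open>q(z) = k\<close> bounds the cosine deficit, since
  weighting its nonnegative terms by the moduli, which are at least \<open>1\<close>, can only increase it.
  The imaginary part shows that \<open>\<theta>\<close> cannot be below \<open>\<pi> / M\<close>: all \<open>sin (\<theta> L\<^sub>i)\<close> would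
  be positive.
\<close>

lemma q_fun_root_near_unit_circle:
  fixes M x :: real
  assumes k: "0 < k"
    and len: "\<And>i. i < k \<Longrightarrow> 1 \<le> len i" "\<And>i. i < k \<Longrightarrow> real (len i) \<le> M"
    and x: "0 \<le> x" "2 * M * x \<le> 1"
    and z: "1 - x \<le> cmod z" "cmod z \<le> 1" "z \<noteq> 1"
    and q: "q_fun k len z = of_nat k"
  obtains \<theta> where "0 \<le> \<theta>" "\<theta> \<le> pi" "pi \<le> M * \<theta>"
    and "(\<Sum>i<k. 1 - cos (\<theta> * real (len i))) \<le> real k * (2 * M * x)"
proof
  define r where "r = cmod z"
  define \<alpha> where "\<alpha> = Arg z"
  define w where "w i = 1 / r ^ len i" for i
  have M: "1 \<le> M" using len[of 0] k by linarith
  have "x \<le> M * x" using M x(1) by (simp add: mult_le_cancel_right1)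
  then have "x \<le> 1 / 2" using x(2) by linarith
  then have r: "0 < r" "r \<le> 1" "1 - x \<le> r" using z by (auto simp: r_def)
  have z_eq: "z = rcis r \<alpha>" by (simp add: r_def \<alpha>_def rcis_cmod_Arg)
  have re: "(\<Sum>i<k. cos (\<alpha> * real (len i)) * w i) = real k"
    using q unfolding z_eq q_fun_polar by (simp add: complex_eq_iff w_def)
  have im: "(\<Sum>i<k. sin (\<alpha> * real (len i)) * w i) = 0"
    using q unfolding z_eq q_fun_polar by (simp add: complex_eq_iff w_def)
  have w1: "1 \<le> w i" for i
    using r by (simp add: w_def power_le_one)
  have w2: "w i \<le> 1 + 2 * M * x" if "i < k" for i
  proof -
    have "real (len i) * x \<le> M * x" using len(2)[OF that] x(1) by (rule mult_right_mono)
    moreover from this have "w i \<le> 1 + 2 * (real (len i) * x)"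
      unfolding w_def using x r by (intro inverse_power_le_of_near_1) auto
    ultimately show ?thesis by linarith
  qed
  show "0 \<le> \<bar>\<alpha>\<bar>" "\<bar>\<alpha>\<bar> \<le> pi"
    using Arg_bounded[of z] by (auto simp: \<alpha>_def)
  have "(\<Sum>i<k. 1 - cos (\<bar>\<alpha>\<bar> * real (len i))) = (\<Sum>i<k. 1 - cos (\<alpha> * real (len i)))"
    by (cases "\<alpha> \<ge> 0") auto
  also have "\<dots> \<le> (\<Sum>i<k. (1 - cos (\<alpha> * real (len i))) * w i)"
    using mult_left_mono[OF w1] by (intro sum_mono) fastforce
  also have "\<dots> = (\<Sum>i<k. w i) - real k"
    using re by (simp add: left_diff_distrib sum_subtractf)
  also have "\<dots> \<le> (\<Sum>i<k. 1 + 2 * M * x) - real k"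
    using w2 by (intro diff_right_mono sum_mono) auto
  also have "\<dots> = real k * (2 * M * x)"
    by (simp add: algebra_simps)
  finally show "(\<Sum>i<k. 1 - cos (\<bar>\<alpha>\<bar> * real (len i))) \<le> real k * (2 * M * x)" .
  show "pi \<le> M * \<bar>\<alpha>\<bar>"
  proof (rule ccontr)
    assume small: "\<not> pi \<le> M * \<bar>\<alpha>\<bar>"
    show False
    \<comment> \<open>at angle \<open>0\<close> the moduli must average to \<open>1\<close>, so each of them equals \<open>1\<close>, as then does \<open>r\<close>\<close>
    proof (cases "\<alpha> = 0")
      case True
      then have "(\<Sum>i<k. w i - 1) = 0" using re by (simp add: sum_subtractf)
      then have "\<forall>i\<in>{..<k}. w i - 1 = 0"
        using w1 by (subst (asm) sum_nonneg_eq_0_iff) auto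
      then have "r ^ len 0 = 1" using k r by (auto simp: w_def)
      then have "r = 1"
        using len(1)[of 0] k r power_eq_imp_eq_base[of r "len 0" 1] by auto
      with True z_eq z(3) show False by simp
    next
      case False
      have pos: "0 < sin (\<bar>\<alpha>\<bar> * real (len i)) * w i" if "i \<in> {..<k}" for i
      proof -
        have "\<bar>\<alpha>\<bar> * real (len i) \<le> \<bar>\<alpha>\<bar> * M"
          using len(2)[of i] that by (intro mult_left_mono) auto
        then have "\<bar>\<alpha>\<bar> * real (len i) < pi" using small by (simp add: mult.commute)
        moreover have "0 < \<bar>\<alpha>\<bar> * real (len i)"
          using len(1)[of i] that False by (intro mult_pos_pos) auto
        ultimately have "0 < sin (\<bar>\<alpha>\<bar> * real (len i))" by (intro sin_gt_zero)
        moreover have "0 < w i" using w1[of i] by linarith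
        ultimately show ?thesis by simp
      qed
      have "0 < (\<Sum>i<k. sin (\<bar>\<alpha>\<bar> * real (len i)) * w i)"
        using k by (intro sum_pos pos) auto
      also have "(\<Sum>i<k. sin (\<bar>\<alpha>\<bar> * real (len i)) * w i)
          = sgn \<alpha> * (\<Sum>i<k. sin (\<alpha> * real (len i)) * w i)"
        using False by (cases "\<alpha> > 0") (auto simp: sum_negf)
      finally show False using im by simp
    qed
  qed
qed

lemma abs_cos_diff_le: "\<bar>cos a - cos b\<bar> \<le> \<bar>a - b\<bar>" for a b :: real
proof -
  have "\<bar>cos a - cos b\<bar> = 2 * (\<bar>sin ((a + b) / 2)\<bar> * \<bar>sin ((b - a) / 2)\<bar>)"
    by (simp add: cos_diff_cos abs_mult)
  also have "\<dots> \<le> 2 * (1 * \<bar>(b - a) / 2\<bar>)"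
    by (intro mult_left_mono mult_mono abs_sin_x_le_abs_x) auto
  finally show ?thesis by simp
qed

text \<open>
  Rounding \<open>\<theta>\<close> down to a multiple of \<open>\<eta> / M\<close> moves each \<open>\<theta> L\<^sub>i\<close> by at most \<open>\<eta>\<close>,
  hence each cosine by at most \<open>\<eta>\<close>. This reduces the continuum of angles to a finite grid.
\<close>

lemma cos_deficit_round_to_grid:
  fixes M \<eta> \<theta> :: real
  assumes M: "0 < M" and \<eta>: "0 < \<eta>" and len: "\<And>i. i < k \<Longrightarrow> real (len i) \<le> M"
    and \<theta>: "0 \<le> \<theta>"
    and s: "(\<Sum>i<k. 1 - cos (\<theta> * real (len i))) \<le> real k * \<eta>"
  obtains j :: nat where "\<theta> - \<eta> / M < real j * (\<eta> / M)" "real j * (\<eta> / M) \<le> \<theta>"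
    and "(\<Sum>i<k. 1 - cos (real j * (\<eta> / M) * real (len i))) \<le> 2 * real k * \<eta>"
proof
  define h where "h = \<eta> / M"
  have h: "0 < h" using M \<eta> by (simp add: h_def)
  define j where "j = nat \<lfloor>\<theta> / h\<rfloor>"
  have j: "real j \<le> \<theta> / h" "\<theta> / h < real j + 1"
    using \<theta> h by (auto simp: j_def)
  then have a: "real j * h \<le> \<theta>" and b: "\<theta> - h < real j * h"
    using h by (auto simp: field_simps)
  then show "\<theta> - \<eta> / M < real j * (\<eta> / M)" "real j * (\<eta> / M) \<le> \<theta>"
    by (auto simp: h_def)
  have "(\<Sum>i<k. 1 - cos (real j * h * real (len i)))
      \<le> (\<Sum>i<k. (1 - cos (\<theta> * real (len i))) + \<eta>)"
  proof (rule sum_mono)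
    fix i assume i: "i \<in> {..<k}"
    have "\<bar>cos (\<theta> * real (len i)) - cos (real j * h * real (len i))\<bar>
        \<le> \<bar>\<theta> * real (len i) - real j * h * real (len i)\<bar>"
      by (rule abs_cos_diff_le)
    also have "\<dots> = (\<theta> - real j * h) * real (len i)"
      using a by (simp add: left_diff_distrib[symmetric] abs_mult)
    also have "\<dots> \<le> h * M"
      using a b h len i by (intro mult_mono) auto
    also have "\<dots> = \<eta>" using M by (simp add: h_def)
    finally show "1 - cos (real j * h * real (len i)) \<le> 1 - cos (\<theta> * real (len i)) + \<eta>"
      by linarith
  qed
  also have "\<dots> = (\<Sum>i<k. 1 - cos (\<theta> * real (len i))) + real k * \<eta>"
    by (simp add: sum.distrib)
  also have "\<dots> \<le> 2 * real k * \<eta>" using s by linarith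
  finally show "(\<Sum>i<k. 1 - cos (real j * (\<eta> / M) * real (len i))) \<le> 2 * real k * \<eta>"
    by (simp add: h_def)
qed

text \<open>
  As \<open>cos\<close> decreases on \<open>[0, \<pi>]\<close>, only \<open>\<theta> = t\<close> has to be considered, where
  \<open>1 - cos t = 2 sin\<^sup>2 (t / 2)\<close> and \<open>sin y \<ge> y - y\<^sup>3 / 6 \<ge> 23 y / 24\<close> for
  \<open>0 \<le> y \<le> 1 / 2\<close>.
\<close>

lemma one_minus_cos_ge:
  fixes t \<theta> :: real
  assumes t: "0 \<le> t" "t \<le> 1" and \<theta>: "t \<le> \<theta>" "\<theta> \<le> pi"
  shows "t\<^sup>2 / 3 \<le> 1 - cos \<theta>"
proof -
  define y where "y = t / 2"
  have y: "0 \<le> y" "y \<le> 1 / 2" using t by (auto simp: y_def)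
  have "\<bar>sin y - y\<bar> \<le> y ^ 3 / 6"
    using Maclaurin_sin_bound[of y 3] y
    by (simp add: numeral_3_eq_3 sin_coeff_def fact_numeral)
  moreover have "y ^ 3 \<le> y / 4"
  proof -
    have "y * y \<le> 1 / 2 * (1 / 2)" using y by (intro mult_mono) auto
    from mult_left_mono[OF this y(1)] show ?thesis by (simp add: power3_eq_cube mult_ac)
  qed
  ultimately have "23 / 24 * y \<le> sin y" by linarith
  then have "(23 / 24 * y)\<^sup>2 \<le> (sin y)\<^sup>2" using y by (intro power_mono) auto
  moreover have "cos t = 1 - 2 * (sin y)\<^sup>2"
    using cos_double_sin[of y] by (simp add: y_def)
  moreover have "t\<^sup>2 / 3 \<le> 2 * (23 / 24 * y)\<^sup>2"
    by (simp add: y_def power_mult_distrib power_divide)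
  moreover have "cos \<theta> \<le> cos t"
    using t \<theta> by (intro cos_monotone_0_pi_le) auto
  ultimately show ?thesis by linarith
qed

section \<open>Probability of a root near the unit circle\<close>

text \<open>
  With \<open>u = 1 - cos \<theta>\<close> and \<open>p = 1 / L\<close>, the exact mean is at least \<open>u / (p\<^sup>2 + 2 u)\<close>.
  The hypothesis on \<open>\<theta>\<close> makes \<open>p\<^sup>2\<close> at most \<open>3 B\<^sup>2 u\<close>, and the scale \<open>L\<close> cancels.
\<close>

lemma expectation_one_minus_cos_geometric_ge:
  fixes B L \<theta> :: real
  assumes L: "1 \<le> L" and B: "1 \<le> B" and \<theta>: "1 / (B * L) \<le> \<theta>" "\<theta> \<le> pi"
  shows "1 / (5 * B\<^sup>2)
      \<le> measure_pmf.expectation (geometric_pmf (1 / L)) (\<lambda>n. 1 - cos (\<theta> * real (Suc n)))"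
proof -
  define p where "p = 1 / L"
  define u where "u = 1 - cos \<theta>"
  have p: "0 < p" "p \<le> 1" using L by (auto simp: p_def)
  have BL: "1 * 1 \<le> B * L" using B L by (intro mult_mono) auto
  have u_ge: "(1 / (B * L))\<^sup>2 / 3 \<le> u"
    unfolding u_def using BL \<theta> by (intro one_minus_cos_ge) auto
  moreover have "0 < (1 / (B * L))\<^sup>2 / 3" using B L by simp
  ultimately have "0 < u" by linarith
  moreover have "p\<^sup>2 \<le> 3 * B\<^sup>2 * u"
    using u_ge B L by (simp add: p_def field_simps power2_eq_square)
  ultimately have u: "p\<^sup>2 \<le> 3 * B\<^sup>2 * u" "0 < u" by auto
  have B2: "1 \<le> B\<^sup>2" using B by (simp add: one_le_power)
  have "1 / (5 * B\<^sup>2) \<le> u / (p\<^sup>2 + 2 * u)"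
  proof -
    define v where "v = B\<^sup>2 * u"
    have "u \<le> v" using mult_right_mono[OF B2, of u] u by (simp add: v_def)
    moreover have "p\<^sup>2 \<le> 3 * v" "u * (5 * B\<^sup>2) = 5 * v" using u by (simp_all add: v_def)
    ultimately have "p\<^sup>2 + 2 * u \<le> u * (5 * B\<^sup>2)" by linarith
    moreover have "0 < p\<^sup>2 + 2 * u" using u by (intro add_nonneg_pos) auto
    ultimately show ?thesis using B2 B by (simp add: divide_simps mult.commute)
  qed
  also have "\<dots> \<le> (2 - p) * u / (p\<^sup>2 + 2 * (1 - p) * u)"
  proof (rule frac_le)
    show "u \<le> (2 - p) * u" using u p by (simp add: mult_le_cancel_right1)
    show "0 < p\<^sup>2 + 2 * (1 - p) * u" using u p by (intro add_pos_nonneg) auto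
    show "p\<^sup>2 + 2 * (1 - p) * u \<le> p\<^sup>2 + 2 * u" using u p by (simp add: algebra_simps)
  qed (use u p in auto)
  also have "\<dots> = measure_pmf.expectation (geometric_pmf p) (\<lambda>n. 1 - cos (\<theta> * real (Suc n)))"
    unfolding u_def by (rule expectation_one_minus_cos_geometric[OF p, symmetric])
  finally show ?thesis unfolding p_def .
qed

lemma prob_B_graph_cos_deficit_le:
  fixes B L \<theta> a :: real
  assumes L: "1 \<le> L" and B: "1 \<le> B" and \<theta>: "1 / (B * L) \<le> \<theta>" "\<theta> \<le> pi"
  shows "measure_pmf.prob (B_graph L k) {len. (\<Sum>i<k. 1 - cos (\<theta> * real (len i))) \<le> a}
           \<le> exp (a - real k / (15 * B\<^sup>2))"
proof -
  let ?P = "map_pmf Suc (geometric_pmf (1 / L))"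
  define f where "f n = 1 - cos (\<theta> * real n)" for n
  have "measure_pmf.prob (B_graph L k) {len. (\<Sum>i\<in>{..<k}. f (len i)) \<le> a}
      \<le> exp (a - real (card {..<k}) * measure_pmf.expectation ?P f / 3)"
    unfolding B_graph_def
  proof (rule prob_Pi_pmf_sum_le)
    show "f x \<le> 2" for x
      using cos_ge_minus_one[of "\<theta> * real x"] by (simp add: f_def)
  qed (auto simp: f_def)
  also have "\<dots> \<le> exp (a - real k / (15 * B\<^sup>2))"
  proof -
    have "1 / (5 * B\<^sup>2) \<le> measure_pmf.expectation ?P f"
      using expectation_one_minus_cos_geometric_ge[OF assms] by (simp add: f_def)
    then have "real k * (1 / (5 * B\<^sup>2)) \<le> real k * measure_pmf.expectation ?P f"
      by (intro mult_left_mono) auto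
    then show ?thesis by simp
  qed
  finally show ?thesis by (simp add: f_def)
qed

text \<open>
  A union bound; the summand \<open>1\<close> in the exponent pays for rounding \<open>B L\<close> down to an integer.
\<close>

lemma prob_B_graph_long_arc_le:
  fixes B L :: real
  assumes L: "1 \<le> L" and B: "0 \<le> B"
  shows "measure_pmf.prob (B_graph L k) {len. \<exists>i<k. B * L < real (len i)} \<le> real k * exp (1 - B)"
proof -
  define n where "n = nat \<lfloor>B * L\<rfloor>"
  have BL: "0 \<le> B * L" using B L by simp
  have one: "measure_pmf.prob (B_graph L k) {len. B * L < real (len i)} \<le> exp (1 - B)"
    if "i < k" for i
  proof -
    have "measure_pmf.prob (B_graph L k) {len. B * L < real (len i)}
        = measure_pmf.prob (map_pmf (\<lambda>len. len i) (B_graph L k)) {l. B * L < real l}"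
      by (simp add: vimage_def)
    also have "map_pmf (\<lambda>len. len i) (B_graph L k) = map_pmf Suc (geometric_pmf (1 / L))"
      using that unfolding B_graph_def by (subst Pi_pmf_component) auto
    also have "measure_pmf.prob \<dots> {l. B * L < real l}
        = measure_pmf.prob (geometric_pmf (1 / L)) {n..}"
    proof -
      have "Suc -` {l. B * L < real l} = {n..}"
        unfolding n_def using BL by (auto simp: vimage_def) linarith+
      then show ?thesis by simp
    qed
    also have "\<dots> = (1 - 1 / L) ^ n"
      using L by (intro prob_geometric_ge) auto
    also have "\<dots> \<le> exp (- 1 / L) ^ n"
      using L exp_ge_add_one_self[of "- 1 / L"] by (intro power_mono) auto
    also have "\<dots> = exp (- real n / L)"
      by (simp add: exp_of_nat_mult[symmetric])
    also have "\<dots> \<le> exp (1 - B)"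
    proof -
      have "B * L \<le> real n + L" unfolding n_def using BL L by linarith
      then have "B \<le> real n / L + 1" using L by (simp add: field_simps)
      then show ?thesis by simp
    qed
    finally show ?thesis .
  qed
  have "measure_pmf.prob (B_graph L k) {len. \<exists>i<k. B * L < real (len i)}
      = measure_pmf.prob (B_graph L k) (\<Union>i\<in>{..<k}. {len. B * L < real (len i)})"
    by (rule arg_cong[where f = "measure_pmf.prob _"]) auto
  also have "\<dots> \<le> (\<Sum>i\<in>{..<k}. measure_pmf.prob (B_graph L k) {len. B * L < real (len i)})"
    by (rule measure_pmf.finite_measure_subadditive_finite) auto
  also have "\<dots> \<le> (\<Sum>i\<in>{..<k}. exp (1 - B))"
    by (intro sum_mono one) auto
  finally show ?thesis by simp
qed

text \<open>
  The non-asymptotic core: \<open>B\<close> is the maximal arc size in units of \<open>L\<close>. Outside the event of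
  a long arc, a root produces a small cosine deficit at an angle of the grid with spacing
  \<open>2 x\<close>, and this grid has at most \<open>2 / x + 1\<close> points in \<open>[0, \<pi>]\<close>. The smallness condition
  on \<open>x\<close> says that the deficit forced by a root, doubled by rounding to the grid, is at most half of the
  threshold \<open>k / (15 B\<^sup>2)\<close> in the tail bound.
\<close>

lemma prob_q_fun_root_near_unit_circle_le:
  fixes B L x :: real
  assumes k: "0 < k" and L: "1 \<le> L" and B: "1 \<le> B" and x: "0 < x"
    and small: "120 * B ^ 3 * L * x \<le> 1"
  shows "measure_pmf.prob (B_graph L k)
           {len. \<exists>z. 1 - x \<le> cmod z \<and> cmod z \<le> 1 \<and> z \<noteq> 1 \<and> q_fun k len z = of_nat k}
         \<le> real k * exp (1 - B) + (2 / x + 1) * exp (- real k / (30 * B\<^sup>2))"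
    (is "measure_pmf.prob ?M ?root \<le> _")
proof -
  define M where "M = B * L"
  define \<eta> where "\<eta> = 2 * M * x"
  define J where "J = {j::nat. 1 / M \<le> real j * (2 * x) \<and> real j * (2 * x) \<le> pi}"
  define low where "low j = {len. (\<Sum>i<k. 1 - cos (real j * (2 * x) * real (len i)))
      \<le> 2 * real k * \<eta>}" for j
  define long where "long = {len. \<exists>i<k. M < real (len i)}"
  have "1 * 1 \<le> M" unfolding M_def using B L by (intro mult_mono) auto
  then have M: "1 \<le> M" by simp
  have \<eta>: "0 < \<eta>" using M x by (simp add: \<eta>_def)
  have h: "\<eta> / M = 2 * x" using M by (simp add: \<eta>_def)
  have B2: "1 \<le> B\<^sup>2" using B by (simp add: one_le_power)
  have \<eta>B: "60 * B\<^sup>2 * \<eta> \<le> 1"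
    using small by (simp add: \<eta>_def M_def power2_eq_square power3_eq_cube mult_ac)
  have "1 * \<eta> \<le> B\<^sup>2 * \<eta>" using B2 \<eta> by (intro mult_right_mono) auto
  then have \<eta>1: "60 * \<eta> \<le> 1" using \<eta>B by simp
  have Jsub: "J \<subseteq> {..nat \<lfloor>2 / x\<rfloor>}"
  proof
    fix j assume "j \<in> J"
    then have "real j * (2 * x) \<le> pi" by (simp add: J_def)
    then have "real j * (2 * x) \<le> 4" using pi_less_4 by linarith
    then have "real j \<le> 2 / x" using x by (simp add: field_simps)
    then show "j \<in> {..nat \<lfloor>2 / x\<rfloor>}" by (simp add: le_nat_floor)
  qed
  then have finJ: "finite J" by (rule finite_subset) simp
  have "card J \<le> card {..nat \<lfloor>2 / x\<rfloor>}" using Jsub by (intro card_mono) auto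
  then have "real (card J) \<le> real (nat \<lfloor>2 / x\<rfloor>) + 1" by simp
  also have "real (nat \<lfloor>2 / x\<rfloor>) \<le> 2 / x" using x by (intro of_nat_floor) simp
  finally have cardJ: "real (card J) \<le> 2 / x + 1" by simp
  have cover: "len \<in> long \<union> (\<Union>j\<in>J. low j)" if root: "len \<in> ?root" and supp: "len \<in> set_pmf ?M" for len
  proof (cases "len \<in> long")
    case False
    then have le: "real (len i) \<le> M" if "i < k" for i
      using False that not_less unfolding long_def mem_Collect_eq by blast
    have ge: "1 \<le> len i" if "i < k" for i
      using B_graph_arc_size_pos[OF supp that] .
    obtain z where z: "1 - x \<le> cmod z" "cmod z \<le> 1" "z \<noteq> 1" "q_fun k len z = of_nat k"
      using root by auto
    have x0: "0 \<le> x" "2 * M * x \<le> 1" using x \<eta>1 \<eta> by (auto simp: \<eta>_def)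
    obtain \<theta> where \<theta>: "0 \<le> \<theta>" "\<theta> \<le> pi" "pi \<le> M * \<theta>"
      and s: "(\<Sum>i<k. 1 - cos (\<theta> * real (len i))) \<le> real k * \<eta>"
      using q_fun_root_near_unit_circle[OF k ge le x0 z] unfolding \<eta>_def by blast
    have M0: "0 < M" using M by simp
    obtain j where j: "\<theta> - \<eta> / M < real j * (\<eta> / M)" "real j * (\<eta> / M) \<le> \<theta>"
      and sj: "(\<Sum>i<k. 1 - cos (real j * (\<eta> / M) * real (len i))) \<le> 2 * real k * \<eta>"
      using cos_deficit_round_to_grid[OF M0 \<eta> le \<theta>(1) s] by blast
    \<comment> \<open>rounding down keeps the angle above \<open>1 / M\<close>, because \<open>\<theta> M \<ge> \<pi>\<close> and \<open>\<eta>\<close> is small\<close>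
    have "1 / M \<le> \<theta> - \<eta> / M"
    proof -
      have "1 + \<eta> \<le> M * \<theta>" using \<eta>1 pi_gt3 \<theta>(3) by linarith
      then show ?thesis using M by (simp add: field_simps)
    qed
    then have "j \<in> J" using j \<theta>(2) unfolding J_def h by auto
    moreover have "len \<in> low j" using sj unfolding low_def h by simp
    ultimately show ?thesis by blast
  qed simp
  have lowp: "measure_pmf.prob ?M (low j) \<le> exp (- real k / (30 * B\<^sup>2))" if "j \<in> J" for j
  proof -
    have "measure_pmf.prob ?M (low j) \<le> exp (2 * real k * \<eta> - real k / (15 * B\<^sup>2))"
      unfolding low_def using that
      by (intro prob_B_graph_cos_deficit_le L B) (auto simp: J_def M_def)
    also have "\<dots> \<le> exp (- real k / (30 * B\<^sup>2))"
    proof -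
      have "2 * \<eta> \<le> 1 / (30 * B\<^sup>2)" using \<eta>B B2 by (subst pos_le_divide_eq) (auto simp: mult_ac)
      then have "real k * (2 * \<eta>) \<le> real k * (1 / (30 * B\<^sup>2))" by (intro mult_left_mono) auto
      then show ?thesis by (simp add: field_simps)
    qed
    finally show ?thesis .
  qed
  have "measure_pmf.prob ?M ?root \<le> measure_pmf.prob ?M (long \<union> (\<Union>j\<in>J. low j))"
    using cover by (intro measure_pmf.finite_measure_mono_AE) (auto simp: AE_measure_pmf_iff)
  also have "\<dots> \<le> measure_pmf.prob ?M long + measure_pmf.prob ?M (\<Union>j\<in>J. low j)"
    by (rule measure_Un_le) auto
  also have "measure_pmf.prob ?M (\<Union>j\<in>J. low j) \<le> (\<Sum>j\<in>J. measure_pmf.prob ?M (low j))"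
    using finJ by (intro measure_pmf.finite_measure_subadditive_finite) auto
  also have "\<dots> \<le> (\<Sum>j\<in>J. exp (- real k / (30 * B\<^sup>2)))"
    by (intro sum_mono lowp)
  also have "\<dots> = real (card J) * exp (- real k / (30 * B\<^sup>2))"
    by simp
  also have "\<dots> \<le> (2 / x + 1) * exp (- real k / (30 * B\<^sup>2))"
    using cardJ by (intro mult_right_mono) auto
  also have "measure_pmf.prob ?M long \<le> real k * exp (1 - B)"
    unfolding long_def M_def using L B by (intro prob_B_graph_long_arc_le) auto
  finally show ?thesis by simp
qed

section \<open>Eigenvalues of the pure drift chain\<close>

text \<open>
  The action of the transition operator on a function on the nodes.
\<close>

lemma sum_pmf_pure_drift_step:
  fixes f :: "node \<Rightarrow> complex"
  assumes len: "\<And>i. i < k \<Longrightarrow> 1 \<le> len i" and x: "x \<in> nodes k len"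
  shows "(\<Sum>y\<in>nodes k len. of_real (pmf (pure_drift_step k len x) y) * f y)
       = (if x = arc_end len (fst x) then (\<Sum>j<k. f (arc_start j)) / of_nat k
          else f (fst x, Suc (snd x)))"
proof -
  have fin: "finite (nodes k len)" by (auto simp: nodes_def)
  obtain i t where it: "x = (i, t)" "i < k" "t < len i"
    using x by (auto simp: nodes_def)
  show ?thesis
  proof (cases "x = arc_end len (fst x)")
    case True
    have inj: "inj_on arc_start {..<k}" by (auto simp: inj_on_def arc_start_def)
    have ne: "{..<k} \<noteq> {}" using it by auto
    have sub: "arc_start ` {..<k} \<subseteq> nodes k len"
      using len by (auto simp: nodes_def arc_start_def Suc_le_eq)
    have "pure_drift_step k len x = pmf_of_set (arc_start ` {..<k})"
      using True inj ne by (simp add: pure_drift_step_def map_pmf_of_set_inj)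
    then have "pmf (pure_drift_step k len x) y = indicator (arc_start ` {..<k}) y / real k" for y
      using ne inj by (simp add: card_image)
    then have "(\<Sum>y\<in>nodes k len. of_real (pmf (pure_drift_step k len x) y) * f y)
        = (\<Sum>y\<in>arc_start ` {..<k}. f y / of_nat k)"
      by (intro sum.mono_neutral_cong_right fin sub) (auto simp: indicator_def)
    also have "\<dots> = (\<Sum>j<k. f (arc_start j)) / of_nat k"
      by (simp add: sum.reindex[OF inj] sum_divide_distrib)
    finally show ?thesis using True by simp
  next
    case False
    then have "(i, Suc t) \<in> nodes k len"
      using it by (auto simp: arc_end_def nodes_def)
    then have "(\<Sum>y\<in>nodes k len. of_real (pmf (pure_drift_step k len x) y) * f y)
        = (\<Sum>y\<in>{(i, Suc t)}. f y)"
      using False it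
      by (intro sum.mono_neutral_cong_right fin)
         (auto simp: pure_drift_step_def pmf_return indicator_def)
    then show ?thesis using False it by simp
  qed
qed

text \<open>
  The enumeration of the nodes is eliminated once and for all: vectors are functions on the nodes.
\<close>

lemma eigenvalue_pure_drift_matrix_iff:
  fixes \<mu> :: complex
  assumes len: "\<And>i. i < k \<Longrightarrow> 1 \<le> len i"
  shows "eigenvalue (map_mat complex_of_real (pure_drift_matrix k len)) \<mu> \<longleftrightarrow>
    (\<exists>f. (\<exists>x\<in>nodes k len. f x \<noteq> 0) \<and>
       (\<forall>x\<in>nodes k len. \<mu> * f x =
         (if x = arc_end len (fst x) then (\<Sum>j<k. f (arc_start j)) / of_nat k
          else f (fst x, Suc (snd x)))))"
    (is "eigenvalue ?A \<mu> \<longleftrightarrow> (\<exists>f. ?nz f \<and> ?eq f)")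
proof -
  define xs where "xs = node_list k len"
  define n where "n = length xs"
  have bij: "bij_betw ((!) xs) {..<n} (nodes k len)"
    unfolding n_def xs_def using distinct_node_list set_node_list
    by (intro bij_betw_nth) auto
  then have img: "nodes k len = (!) xs ` {..<n}"
    by (simp add: bij_betw_def)
  have all: "(\<forall>r\<in>{..<n}. P (xs ! r)) \<longleftrightarrow> (\<forall>x\<in>nodes k len. P x)" for P
    unfolding img by simp
  have dim: "dim_row ?A = n" "dim_col ?A = n"
    by (simp_all add: pure_drift_matrix_def transition_matrix_def n_def xs_def)
  have row: "vec_index (?A *\<^sub>v vec n (\<lambda>r. f (xs ! r))) r =
      (\<Sum>y\<in>nodes k len. of_real (pmf (pure_drift_step k len (xs ! r)) y) * f y)"
    if "r < n" for f r
  proof -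
    have "vec_index (?A *\<^sub>v vec n (\<lambda>r. f (xs ! r))) r
       = (\<Sum>s<n. of_real (pmf (pure_drift_step k len (xs ! r)) (xs ! s)) * f (xs ! s))"
      using that dim
      by (simp add: scalar_prod_def pure_drift_matrix_def transition_matrix_def
          flip: xs_def n_def) (simp add: lessThan_atLeast0)
    also have "\<dots> = (\<Sum>y\<in>nodes k len. of_real (pmf (pure_drift_step k len (xs ! r)) y) * f y)"
      by (rule sum.reindex_bij_betw[OF bij])
    finally show ?thesis .
  qed
  have char: "eigenvector ?A (vec n (\<lambda>r. f (xs ! r))) \<mu> \<longleftrightarrow> ?nz f \<and> ?eq f" for f
  proof -
    have "vec n (\<lambda>r. f (xs ! r)) \<noteq> 0\<^sub>v n \<longleftrightarrow> (\<exists>r\<in>{..<n}. f (xs ! r) \<noteq> 0)"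
      by (auto simp: vec_eq_iff)
    also have "\<dots> \<longleftrightarrow> ?nz f"
      unfolding img by simp
    finally have 1: "vec n (\<lambda>r. f (xs ! r)) \<noteq> 0\<^sub>v n \<longleftrightarrow> ?nz f" .
    have "?A *\<^sub>v vec n (\<lambda>r. f (xs ! r)) = \<mu> \<cdot>\<^sub>v vec n (\<lambda>r. f (xs ! r)) \<longleftrightarrow>
      (\<forall>r\<in>{..<n}. \<mu> * f (xs ! r) =
        (\<Sum>y\<in>nodes k len. of_real (pmf (pure_drift_step k len (xs ! r)) y) * f y))"
      using row dim by (auto simp: vec_eq_iff)
    also have "\<dots> \<longleftrightarrow> (\<forall>x\<in>nodes k len. \<mu> * f x =
        (\<Sum>y\<in>nodes k len. of_real (pmf (pure_drift_step k len x) y) * f y))"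
      by (rule all)
    also have "\<dots> \<longleftrightarrow> ?eq f"
      using sum_pmf_pure_drift_step[OF len] by simp
    finally show ?thesis
      using 1 dim unfolding eigenvector_def by auto
  qed
  show ?thesis
  proof
    assume "eigenvalue ?A \<mu>"
    then obtain v where v: "eigenvector ?A v \<mu>" by (auto simp: eigenvalue_def)
    define f where "f y = vec_index v (inv_into {..<n} ((!) xs) y)" for y
    have "v = vec n (\<lambda>r. f (xs ! r))"
      using v dim bij
      by (auto simp: eigenvector_def f_def vec_eq_iff bij_betw_def inv_into_f_f)
    with v char[of f] show "\<exists>f. ?nz f \<and> ?eq f" by metis
  next
    assume "\<exists>f. ?nz f \<and> ?eq f"
    then show "eigenvalue ?A \<mu>"
      using char unfolding eigenvalue_def by blast
  qed
qed

text \<open>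
  Along an arc the eigenvector is multiplied by \<open>\<mu>\<close> at each step, so its value at the start
  \<open>a\<^sub>i\<close> is \<open>m \<mu>\<^bsup>- L\<^sub>i\<^esup>\<close>, where \<open>m\<close> is the mean of the values at
  all arc starts. Averaging over \<open>i\<close> gives \<open>k m = q(\<mu>) m\<close>, and \<open>m = 0\<close> would make the
  eigenvector vanish.
\<close>

lemma eigenvalue_imp_q_fun_eq:
  fixes \<mu> :: complex
  assumes len: "\<And>i. i < k \<Longrightarrow> 1 \<le> len i"
    and ev: "eigenvalue (map_mat complex_of_real (pure_drift_matrix k len)) \<mu>"
    and \<mu>: "\<mu> \<noteq> 0"
  shows "q_fun k len \<mu> = of_nat k"
proof -
  have "\<exists>f. (\<exists>x\<in>nodes k len. f x \<noteq> 0) \<and>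
       (\<forall>x\<in>nodes k len. \<mu> * f x =
         (if x = arc_end len (fst x) then (\<Sum>j<k. f (arc_start j)) / of_nat k
          else f (fst x, Suc (snd x))))"
    by (rule iffD1[OF eigenvalue_pure_drift_matrix_iff ev]) (rule len)
  then obtain f where nz: "\<exists>x\<in>nodes k len. f x \<noteq> 0"
    and eq: "\<And>x. x \<in> nodes k len \<Longrightarrow> \<mu> * f x =
         (if x = arc_end len (fst x) then (\<Sum>j<k. f (arc_start j)) / of_nat k
          else f (fst x, Suc (snd x)))"
    by blast
  define m where "m = (\<Sum>j<k. f (arc_start j)) / of_nat k"
  have along: "f (i, t) = \<mu> ^ t * f (arc_start i)" if "i < k" "t < len i" for i t
    using that(2)
  proof (induction t)
    case 0
    then show ?case by (simp add: arc_start_def)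
  next
    case (Suc t)
    then have "f (i, Suc t) = \<mu> * f (i, t)"
      using eq[of "(i, t)"] that(1) by (simp add: nodes_def arc_end_def split: if_splits)
    then show ?case using Suc by simp
  qed
  have start: "f (arc_start i) = \<mu> powi (- int (len i)) * m" if i: "i < k" for i
  proof -
    have "m = \<mu> * f (i, len i - 1)"
      using eq[of "(i, len i - 1)"] i len[OF i] by (simp add: nodes_def arc_end_def m_def)
    also have "\<dots> = \<mu> * \<mu> ^ (len i - 1) * f (arc_start i)"
      using along[OF i, of "len i - 1"] len[OF i] by simp
    also have "\<mu> * \<mu> ^ (len i - 1) = \<mu> ^ len i"
      using len[OF i] by (simp flip: power_Suc)
    finally show ?thesis
      using \<mu> by (simp add: power_int_minus field_simps)
  qed
  have "m \<noteq> 0"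
  proof
    assume "m = 0"
    then have "f (i, t) = 0" if "i < k" "t < len i" for i t
      using along[OF that] start[OF that(1)] by simp
    with nz show False by (auto simp: nodes_def)
  qed
  have k: "k > 0" using nz by (auto simp: nodes_def)
  have "of_nat k * m = (\<Sum>j<k. f (arc_start j))"
    using k by (simp add: m_def)
  also have "\<dots> = q_fun k len \<mu> * m"
    by (simp add: start q_fun_def sum_distrib_right)
  finally show ?thesis using \<open>m \<noteq> 0\<close> by simp
qed

text \<open>
  The function with values \<open>1\<close> and \<open>-1\<close> at two arc starts is annihilated. This ensures that the minimum
  defining the mixing rate ranges over a nonempty set.
\<close>

lemma eigenvalue_0_pure_drift_matrix:
  assumes len: "\<And>i. i < k \<Longrightarrow> 1 \<le> len i" and k: "2 \<le> k"
  shows "eigenvalue (map_mat complex_of_real (pure_drift_matrix k len)) 0"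
proof -
  define f :: "node \<Rightarrow> complex"
    where "f x = (if x = arc_start 0 then 1 else if x = arc_start 1 then - 1 else 0)" for x
  have "(\<Sum>j<k. f (arc_start j)) = (\<Sum>j<k. (if j = 0 then 1 else 0) + (if j = 1 then - 1 else 0))"
    by (intro sum.cong) (auto simp: f_def arc_start_def)
  also have "\<dots> = 0"
    using k by (simp add: sum.distrib)
  finally have "(\<Sum>j<k. f (arc_start j)) = 0" .
  moreover have "arc_start 0 \<in> nodes k len" "f (arc_start 0) \<noteq> 0"
    using len[of 0] k by (auto simp: f_def nodes_def arc_start_def)
  moreover have "f (fst x, Suc (snd x)) = 0" for x
    by (auto simp: f_def arc_start_def)
  ultimately have "\<exists>f :: node \<Rightarrow> complex. (\<exists>x\<in>nodes k len. f x \<noteq> 0) \<and>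
       (\<forall>x\<in>nodes k len. 0 * f x =
         (if x = arc_end len (fst x) then (\<Sum>j<k. f (arc_start j)) / of_nat k
          else f (fst x, Suc (snd x))))"
    by (intro exI[of _ f]) auto
  then show ?thesis
    by (rule iffD2[OF eigenvalue_pure_drift_matrix_iff, rotated]) (rule len)
qed

text \<open>
  Outside the closed unit disc every term of \<open>q(z)\<close> has modulus below \<open>1\<close>. So the condition
  \<open>\<bar>z\<bar> \<le> 1\<close> in the region of excluded roots holds for all eigenvalues.
\<close>

lemma q_fun_eq_imp_norm_le_1:
  assumes len: "\<And>i. i < k \<Longrightarrow> 1 \<le> len i" and k: "0 < k"
    and q: "q_fun k len z = of_nat k"
  shows "cmod z \<le> 1"
proof (rule ccontr)
  assume z: "\<not> cmod z \<le> 1"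
  have "real k = cmod (q_fun k len z)" by (simp add: q)
  also have "\<dots> \<le> (\<Sum>i<k. cmod (z powi (- int (len i))))"
    unfolding q_fun_def by (rule norm_sum)
  also have "\<dots> < (\<Sum>i<k. 1)"
  proof (rule sum_strict_mono)
    fix i assume "i \<in> {..<k}"
    then have "1 < cmod z ^ len i"
      using z len[of i] by (intro one_less_power) auto
    then show "cmod (z powi (- int (len i))) < 1"
      by (simp add: power_int_minus norm_inverse norm_power inverse_less_1_iff)
  qed (use k in auto)
  finally show False by simp
qed

lemma less_mixing_rateI:
  assumes len: "\<And>i. i < k \<Longrightarrow> 1 \<le> len i" and k: "2 \<le> k"
    and a: "a < 1"
    and no: "\<And>z. 1 - a \<le> cmod z \<Longrightarrow> cmod z \<le> 1 \<Longrightarrow> z \<noteq> 1 \<Longrightarrow> q_fun k len z \<noteq> of_nat k"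
  shows "a < mixing_rate (pure_drift_matrix k len)"
proof -
  let ?A = "map_mat complex_of_real (pure_drift_matrix k len)"
  let ?S = "{1 - cmod \<mu> | \<mu>. eigenvalue ?A \<mu> \<and> \<mu> \<noteq> 1}"
  define n where "n = length (node_list k len)"
  have A: "?A \<in> carrier_mat n n"
    by (simp add: pure_drift_matrix_def transition_matrix_def n_def)
  have "char_poly ?A \<noteq> 0"
    using degree_monic_char_poly[OF A] by auto
  then have "finite {\<mu>. eigenvalue ?A \<mu>}"
    unfolding eigenvalue_root_char_poly[OF A] by (rule poly_roots_finite)
  then have "finite ((\<lambda>\<mu>. 1 - cmod \<mu>) ` {\<mu>. eigenvalue ?A \<mu>})" by (rule finite_imageI)
  then have fin: "finite ?S" by (rule finite_subset[rotated]) auto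
  \<comment> \<open>an unspecified minimum over the empty set is excluded by the eigenvalue \<open>0\<close>\<close>
  have ne: "?S \<noteq> {}"
    using eigenvalue_0_pure_drift_matrix[of k len] len k by (auto intro!: exI[of _ 0])
  have "a < 1 - cmod \<mu>" if "eigenvalue ?A \<mu>" "\<mu> \<noteq> 1" for \<mu>
  proof (cases "\<mu> = 0")
    case False
    then have q: "q_fun k len \<mu> = of_nat k"
      using eigenvalue_imp_q_fun_eq[of k len] len that by blast
    moreover have "cmod \<mu> \<le> 1"
      using q_fun_eq_imp_norm_le_1[of k len] len k q by simp
    ultimately show ?thesis
      using no[of \<mu>] that(2) by force
  qed (use a in auto)
  then show ?thesis
    unfolding mixing_rate_def using fin ne by (subst Min_gr_iff) auto
qed

section \<open>The limit regime and the mixing rate\<close>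

text \<open>
  The upper bound on \<open>ln L / ln k\<close> is what lets every estimate depend on \<open>k\<close> alone:
  \<open>L\<close> is at most a fixed power of \<open>k\<close>.
\<close>

lemma eventually_regime:
  assumes "eventually P at_top"
  shows "eventually (\<lambda>(k, L). P k \<and> 1 < L \<and> L \<le> real k powr \<rho>u) (regime \<rho>l \<rho>u)"
proof -
  have "eventually (\<lambda>k::nat. P k \<and> 2 \<le> k) at_top"
    using assms eventually_ge_at_top[of 2] by eventually_elim auto
  then have "eventually (\<lambda>y. (P (fst y) \<and> 2 \<le> fst y) \<and> (1::real) < snd y) (at_top \<times>\<^sub>F at_top)"
    using eventually_gt_at_top[of "1::real"] unfolding eventually_prod_filter by fastforce
  then show ?thesis
    unfolding regime_def eventually_inf_principal
  proof eventually_elim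
    case (elim y)
    obtain k L where y: "y = (k, L)" by fastforce
    have "L \<le> real k powr \<rho>u" if "ln L / ln (real k) < \<rho>u"
    proof -
      have "ln L \<le> \<rho>u * ln (real k)"
        using that elim y by (simp add: field_simps)
      then have "exp (ln L) \<le> exp (\<rho>u * ln (real k))" by simp
      then have "L \<le> exp (\<rho>u * ln (real k))" using elim y by (simp del: exp_le_cancel_iff)
      then show ?thesis using elim y by (simp add: powr_def)
    qed
    then show ?case using elim y by auto
  qed
qed

text \<open>
  The arcs are cut off at \<open>B L\<close> with \<open>B = A ln k\<close>. Taking \<open>A = c + \<rho>u d + 1\<close> makes the
  contribution \<open>e k\<^bsup>1 - A\<^esup>\<close> of long arcs equal to \<open>e k\<^bsup>- c - \<rho>u d\<^esup>\<close>, which has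
  the desired order because \<open>L \<le> k\<^bsup>\<rho>u\<^esup>\<close>. The condition \<open>\<gamma> > 3\<close> is where
  \<open>B\<^sup>3 L x\<close>, a constant multiple of \<open>(ln k)\<^bsup>3 - \<gamma>\<^esup>\<close>, has to vanish.
\<close>

lemma prob_R_region_root_bigo:
  fixes \<rho>l \<rho>u \<gamma> c d :: real
  assumes \<rho>: "0 < \<rho>u" and \<gamma>: "\<gamma> > 3" and c: "0 < c" and d: "0 < d"
  shows "(\<lambda>(k, L). measure_pmf.prob (B_graph L k)
            {len. \<exists>z\<in>R_region \<gamma> k L. q_fun k len z = of_nat k})
         \<in> O[regime \<rho>l \<rho>u](\<lambda>(k, L). real k powr (- c) * L powr (- d))"
proof -
  define A where "A = c + \<rho>u * d + 1"
  have A: "0 < A" using \<rho> c d by (simp add: A_def add_pos_nonneg)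
  define Ex where "Ex k = (2 * real k powr \<rho>u * ln (real k) powr \<gamma> + 1)
      * exp (- real k / (30 * (A * ln (real k))\<^sup>2))" for k :: nat
  have "eventually (\<lambda>k::nat. 3 \<le> k) at_top" by (rule eventually_ge_at_top)
  moreover have "eventually (\<lambda>k::nat. 1 \<le> A * ln (real k)) at_top"
    using A by real_asymp
  moreover have "eventually (\<lambda>k::nat. 120 * (A * ln (real k)) ^ 3 \<le> ln (real k) powr \<gamma>) at_top"
    using A \<gamma> by real_asymp
  moreover have "eventually (\<lambda>k. Ex k \<le> real k powr (- c - \<rho>u * d)) at_top"
    unfolding Ex_def using A \<gamma> \<rho> c d by real_asymp
  ultimately have ev: "eventually (\<lambda>k::nat. 3 \<le> k \<and> 1 \<le> A * ln (real k) \<and>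
      120 * (A * ln (real k)) ^ 3 \<le> ln (real k) powr \<gamma> \<and>
      Ex k \<le> real k powr (- c - \<rho>u * d)) at_top"
    by eventually_elim auto
  show ?thesis
  proof (rule bigoI[where c = "exp 1 + 1"], rule eventually_mono[OF eventually_regime[OF ev]], clarify)
    fix k :: nat and L :: real
    assume k: "3 \<le> k" and B: "1 \<le> A * ln (real k)"
      and cube: "120 * (A * ln (real k)) ^ 3 \<le> ln (real k) powr \<gamma>"
      and Ex: "Ex k \<le> real k powr (- c - \<rho>u * d)"
      and L: "1 < L" and Lk: "L \<le> real k powr \<rho>u"
    define x where "x = 1 / (L * ln (real k) powr \<gamma>)"
    have lk: "0 < ln (real k)" using k by simp
    then have x: "0 < x" using L by (simp add: x_def)
    have "120 * (A * ln (real k)) ^ 3 * L * x \<le> 1"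
      using cube L lk by (simp add: x_def field_simps)
    then have "measure_pmf.prob (B_graph L k)
           {len. \<exists>z. 1 - x \<le> cmod z \<and> cmod z \<le> 1 \<and> z \<noteq> 1 \<and> q_fun k len z = of_nat k}
         \<le> real k * exp (1 - A * ln (real k))
           + (2 / x + 1) * exp (- real k / (30 * (A * ln (real k))\<^sup>2))"
      using k L B x by (intro prob_q_fun_root_near_unit_circle_le) auto
    also have "real k * exp (1 - A * ln (real k)) = exp 1 * real k powr (- c - \<rho>u * d)"
    proof -
      have "real k * exp (1 - A * ln (real k)) = real k powr 1 * (exp 1 * real k powr (- A))"
        using k by (simp add: powr_def exp_diff exp_minus field_simps)
      also have "\<dots> = exp 1 * real k powr (1 + - A)" unfolding powr_add by (simp only: mult_ac)
      finally show ?thesis by (simp add: A_def)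
    qed
    also have "(2 / x + 1) * exp (- real k / (30 * (A * ln (real k))\<^sup>2)) \<le> Ex k"
    proof -
      have "2 / x \<le> 2 * real k powr \<rho>u * ln (real k) powr \<gamma>"
        using Lk by (simp add: x_def mult_right_mono)
      then show ?thesis unfolding Ex_def by (intro mult_right_mono) auto
    qed
    also note Ex
    also have "exp 1 * real k powr (- c - \<rho>u * d) + real k powr (- c - \<rho>u * d)
        = (exp 1 + 1) * (real k powr (- c) * (real k powr \<rho>u) powr (- d))"
      by (simp add: powr_powr powr_add[symmetric] algebra_simps)
    also have "\<dots> \<le> (exp 1 + 1) * (real k powr (- c) * L powr (- d))"
      using L Lk d by (intro mult_left_mono powr_mono2') auto
    finally have "measure_pmf.prob (B_graph L k)
           {len. \<exists>z. 1 - x \<le> cmod z \<and> cmod z \<le> 1 \<and> z \<noteq> 1 \<and> q_fun k len z = of_nat k}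
        \<le> (exp 1 + 1) * (real k powr (- c) * L powr (- d))" by simp
    then show "norm (measure_pmf.prob (B_graph L k)
            {len. \<exists>z\<in>R_region \<gamma> k L. q_fun k len z = of_nat k})
        \<le> (exp 1 + 1) * norm (real k powr (- c) * L powr (- d))"
      by (simp add: R_region_def x_def abs_mult conj_assoc)
  qed
qed

lemma prob_less_mixing_rate_ge:
  fixes L \<gamma> :: real
  assumes k: "2 \<le> k" and a: "1 / (L * ln (real k) powr \<gamma>) < 1"
  shows "1 - measure_pmf.prob (B_graph L k) {len. \<exists>z\<in>R_region \<gamma> k L. q_fun k len z = of_nat k}
       \<le> measure_pmf.prob (B_graph L k)
           {len. mixing_rate (pure_drift_matrix k len) > 1 / (L * ln (real k) powr \<gamma>)}"
proof -
  have "1 - measure_pmf.prob (B_graph L k) {len. \<exists>z\<in>R_region \<gamma> k L. q_fun k len z = of_nat k}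
      = measure_pmf.prob (B_graph L k) (- {len. \<exists>z\<in>R_region \<gamma> k L. q_fun k len z = of_nat k})"
    by (subst measure_pmf.prob_compl[symmetric]) (auto simp: Compl_eq_Diff_UNIV)
  also have "\<dots> \<le> measure_pmf.prob (B_graph L k)
           {len. mixing_rate (pure_drift_matrix k len) > 1 / (L * ln (real k) powr \<gamma>)}"
  proof (rule measure_pmf.finite_measure_mono_AE)
    show "AE len in B_graph L k. len \<in> - {len. \<exists>z\<in>R_region \<gamma> k L. q_fun k len z = of_nat k} \<longrightarrow>
        len \<in> {len. mixing_rate (pure_drift_matrix k len) > 1 / (L * ln (real k) powr \<gamma>)}"
      unfolding AE_measure_pmf_iff
    proof (intro ballI impI)
      fix len assume supp: "len \<in> set_pmf (B_graph L k)"
        and no: "len \<in> - {len. \<exists>z\<in>R_region \<gamma> k L. q_fun k len z = of_nat k}"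
      have "1 / (L * ln (real k) powr \<gamma>) < mixing_rate (pure_drift_matrix k len)"
        using B_graph_arc_size_pos[OF supp] k a no
        by (intro less_mixing_rateI) (auto simp: R_region_def)
      then show "len \<in> {len. mixing_rate (pure_drift_matrix k len) > 1 / (L * ln (real k) powr \<gamma>)}"
        by simp
    qed
  qed auto
  finally show ?thesis .
qed

theorem theorem6:
  fixes \<rho>l \<rho>u \<gamma> :: real
  assumes "0 < \<rho>l" and "\<rho>l < \<rho>u" and "\<gamma> > 4"
  shows "(\<forall>c>0. \<forall>d>0.
            (\<lambda>(k, L). measure_pmf.prob (B_graph L k) {len. \<exists>z\<in>R_region \<gamma> k L. q_fun k len z = of_nat k})
              \<in> O[regime \<rho>l \<rho>u](\<lambda>(k, L). real k powr (- c) * L powr (- d))) \<and>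
         ((\<lambda>(k, L). measure_pmf.prob (B_graph L k)
              {len. mixing_rate (pure_drift_matrix k len) > 1 / (L * ln (real k) powr \<gamma>)})
            \<longlongrightarrow> 1) (regime \<rho>l \<rho>u)"
proof (intro conjI allI impI)
  have bigo: "(\<lambda>(k, L). measure_pmf.prob (B_graph L k)
            {len. \<exists>z\<in>R_region \<gamma> k L. q_fun k len z = of_nat k})
         \<in> O[regime \<rho>l \<rho>u](\<lambda>(k, L). real k powr (- c) * L powr (- d))"
    if "0 < c" "0 < d" for c d
    using that assms by (intro prob_R_region_root_bigo) auto
  then show "(\<lambda>(k, L). measure_pmf.prob (B_graph L k)
            {len. \<exists>z\<in>R_region \<gamma> k L. q_fun k len z = of_nat k})
         \<in> O[regime \<rho>l \<rho>u](\<lambda>(k, L). real k powr (- c) * L powr (- d))"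
    if "0 < c" "0 < d" for c d
    using that by blast
  let ?root = "\<lambda>(k, L). measure_pmf.prob (B_graph L k)
            {len. \<exists>z\<in>R_region \<gamma> k L. q_fun k len z = of_nat k}"
  let ?good = "\<lambda>(k, L). measure_pmf.prob (B_graph L k)
              {len. mixing_rate (pure_drift_matrix k len) > 1 / (L * ln (real k) powr \<gamma>)}"
  have root0: "(?root \<longlongrightarrow> 0) (regime \<rho>l \<rho>u)"
  proof (rule tendstoI)
    fix e :: real assume e: "0 < e"
    have "?root \<in> O[regime \<rho>l \<rho>u](\<lambda>(k, L). real k powr (- 1) * L powr (- 1))"
      by (rule bigo) auto
    then obtain C where C: "0 < C" and
      bd: "eventually (\<lambda>y. norm (?root y) \<le> C * norm ((\<lambda>(k, L). real k powr (- 1) * L powr (- 1)) y))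
        (regime \<rho>l \<rho>u)"
      by (rule landau_o.bigE)
    have "eventually (\<lambda>k::nat. C * real k powr (- 1) < e) at_top"
      using e C by real_asymp
    from bd eventually_regime[OF this] show "eventually (\<lambda>y. dist (?root y) 0 < e) (regime \<rho>l \<rho>u)"
    proof eventually_elim
      case (elim y)
      obtain k L where y: "y = (k, L)" by fastforce
      have "norm (?root y) \<le> C * (real k powr (- 1) * L powr (- 1))"
        using elim y by (simp add: abs_mult)
      also have "\<dots> \<le> C * (real k powr (- 1) * 1)"
        using elim y C by (intro mult_left_mono) (auto simp: powr_minus inverse_le_1_iff)
      also have "\<dots> < e" using elim y by simp
      finally show ?case by simp
    qed
  qed
  have "eventually (\<lambda>k::nat. 2 \<le> k \<and> 1 \<le> ln (real k) powr \<gamma>) at_top"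
    using assms by (intro eventually_conj eventually_ge_at_top) real_asymp
  from eventually_regime[OF this]
  have ge: "eventually (\<lambda>y. 1 - ?root y \<le> ?good y) (regime \<rho>l \<rho>u)"
  proof (rule eventually_mono, clarify)
    fix k :: nat and L :: real
    assume k: "2 \<le> k" "1 \<le> ln (real k) powr \<gamma>" and L: "1 < L"
    have "L * 1 \<le> L * ln (real k) powr \<gamma>"
      using k L by (intro mult_left_mono) auto
    then have "1 < L * ln (real k) powr \<gamma>" using L by linarith
    then show "1 - measure_pmf.prob (B_graph L k) {len. \<exists>z\<in>R_region \<gamma> k L. q_fun k len z = of_nat k}
        \<le> measure_pmf.prob (B_graph L k)
            {len. mixing_rate (pure_drift_matrix k len) > 1 / (L * ln (real k) powr \<gamma>)}"
      using k by (intro prob_less_mixing_rate_ge) auto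
  qed
  show "(?good \<longlongrightarrow> 1) (regime \<rho>l \<rho>u)"
  proof (rule tendsto_sandwich[OF ge])
    show "((\<lambda>y. 1 - ?root y) \<longlongrightarrow> 1) (regime \<rho>l \<rho>u)"
      using tendsto_diff[OF tendsto_const root0, of 1] by simp
    show "eventually (\<lambda>y. ?good y \<le> 1) (regime \<rho>l \<rho>u)"
      by (intro always_eventually) (auto simp: measure_pmf.prob_le_1)
  qed auto
qed

end
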